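(* Let $L$ be a Lie superalgebra, let $c\ge 1$, and suppose $\dim L/Z_c(L)=(m\mid n)$ (with $m,n$ finite). Then $$\dim L^{c+1}\le\frac{1}{c+1}\sum_{a\mid (c+1)}\mu(a)\,\bigl(m-(-1)^a n\bigr)^{\frac{c+1}{a}} .$$
   Context: All vector superspaces are over a field $\mathbb{F}$ of characteristic different from $2$ and $3$. A Lie superalgebra is a $\mathbb{Z}_2$-graded vector space $L=L_{\bar 0}\oplus L_{\bar 1}$ with a bilinear bracket satisfying, for homogeneous elements, $[L_\alpha,L_\beta]\subseteq L_{\alpha+\beta}$, $[x,y]=-(-1)^{|x||y|}[y,x]$, and $(-1)^{|x||z|}[x,[y,z]]+(-1)^{|y||x|}[y,[z,x]]+(-1)^{|z||y|}[z,[x,y]]=0$. The lower central series is $L^1=L$, $L^{k}=[L^{k-1},L]$ for $k\ge 2$ (the span of brackets). The upper central series is $Z_0(L)=\{0\}$, $Z_i(L)=\{x\in L: [x,y]\in Z_{i-1}(L)\ \forall y\in L\}$ for $i\ge 1$, so $Z_1(L)=Z(L)$ is the center. $\dim L/Z_c(L)=(m\mid n)$ means its even part has dimension $m$ and its odd part has dimension $n$; $\dim L^{c+1}$ in the inequality is the total vector space dimension (even plus odd). $\mu$ is the M\"obius function and the sum is over positive divisors $a$ of $c+1$. *)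

theory Defs
  imports
    "HOL-Computational_Algebra.Computational_Algebra"
    "HOL-Library.Set_Algebras"
    "HOL-Library.Z2"
begin

text \<open>
  The parity of a homogeneous element is an index of type \<^typ>\<open>bit\<close>, the integers modulo 2;
  \<open>sign \<alpha> \<beta>\<close> is the scalar \<open>(-1)\<close> to the power \<open>\<alpha> \<beta>\<close>.
\<close>

definition sign :: "bit \<Rightarrow> bit \<Rightarrow> 'k::field" where
  "sign \<alpha> \<beta> = (if \<alpha> * \<beta> = 1 then - 1 else 1)"

text \<open>
  The underlying vector space is the whole type \<open>'v\<close> with scalar multiplication \<open>scale\<close>, of
  arbitrary dimension; \<open>part 0\<close> and \<open>part 1\<close> are the even and the odd part.
\<close>

locale lie_superalgebra = vector_space scale
  for scale :: "'k::field \<Rightarrow> 'v::ab_group_add \<Rightarrow> 'v" (infixr \<open>*s\<close> 75) +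
  fixes part :: "bit \<Rightarrow> 'v set"
    and bracket :: "'v \<Rightarrow> 'v \<Rightarrow> 'v"
  assumes subspace_part: "subspace (part \<alpha>)"
    and part_sum: "\<exists>x\<^sub>0\<in>part 0. \<exists>x\<^sub>1\<in>part 1. x = x\<^sub>0 + x\<^sub>1"
    and part_Int: "part 0 \<inter> part 1 = {0}"
    and linear_bracket_right: "Vector_Spaces.linear scale scale (\<lambda>y. bracket x y)"
    and linear_bracket_left: "Vector_Spaces.linear scale scale (\<lambda>x. bracket x y)"
    and bracket_part: "x \<in> part \<alpha> \<Longrightarrow> y \<in> part \<beta> \<Longrightarrow> bracket x y \<in> part (\<alpha> + \<beta>)"
    and super_antisym: "x \<in> part \<alpha> \<Longrightarrow> y \<in> part \<beta> \<Longrightarrow>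
      bracket x y = - (sign \<alpha> \<beta> *s bracket y x)"
    and super_jacobi: "x \<in> part \<alpha> \<Longrightarrow> y \<in> part \<beta> \<Longrightarrow> z \<in> part \<gamma> \<Longrightarrow>
      sign \<alpha> \<gamma> *s bracket x (bracket y z)
      + sign \<beta> \<alpha> *s bracket y (bracket z x)
      + sign \<gamma> \<beta> *s bracket z (bracket x y) = 0"
begin

text \<open>The series starts at index 1; the value at 0 is a dummy.\<close>

fun lower_central :: "nat \<Rightarrow> 'v set" where
  "lower_central 0 = UNIV"
| "lower_central (Suc 0) = UNIV"
| "lower_central (Suc (Suc k)) = span {bracket x y |x y. x \<in> lower_central (Suc k)}"

primrec upper_central :: "nat \<Rightarrow> 'v set" where
  "upper_central 0 = {0}"
| "upper_central (Suc i) = {x. \<forall>y. bracket x y \<in> upper_central i}"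

end

context vector_space
begin

text \<open>
  For subspaces \<open>W\<close> and \<open>U\<close>: the image of \<open>U\<close> in the quotient by \<open>W\<close>, that is, the space of
  all cosets \<open>x +o W\<close> with \<open>x \<in> U\<close>, has finite dimension \<open>d\<close>. A basis of it is given by
  representatives \<open>b \<in> B\<close>; the linear combination of the cosets \<open>b +o W\<close> with coefficients
  \<open>a b\<close> is the coset of \<open>\<Sum>b\<in>B. a b *s b\<close>, and the zero of the quotient is \<open>W\<close>. The library
  function \<^term>\<open>dim\<close> is not suitable here, since it is 0 on infinite-dimensional spaces and
  there is no quotient space in the library.
\<close>

definition has_dim_mod :: "'b set \<Rightarrow> 'b set \<Rightarrow> nat \<Rightarrow> bool" where
  "has_dim_mod W U d \<longleftrightarrow>
    (\<exists>B. finite B \<and> card B = d \<and> B \<subseteq> U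
      \<and> (\<forall>a. (\<Sum>b\<in>B. scale (a b) b) +o W = W \<longrightarrow> (\<forall>b\<in>B. a b = 0))
      \<and> (\<forall>x\<in>U. \<exists>a. x +o W = (\<Sum>b\<in>B. scale (a b) b) +o W))"

end

text \<open>
  The grading of the quotient by \<open>W\<close> is the induced one: its even and odd part are the images of
  \<open>part 0\<close> and \<open>part 1\<close>.
\<close>

definition (in lie_superalgebra) quotient_superdim :: "'v set \<Rightarrow> nat \<Rightarrow> nat \<Rightarrow> bool" where
  "quotient_superdim W m n \<longleftrightarrow> has_dim_mod W (part 0) m \<and> has_dim_mod W (part 1) n"

definition moebius :: "nat \<Rightarrow> int" where
  "moebius a = (if squarefree a then (- 1) ^ card (prime_factors a) else 0)"

end

theory Submission imports Defs
begin

text \<open>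
  Modulo \<open>Z_c\<close> the algebra is spanned by \<open>m\<close> even and \<open>n\<close> odd elements, and a bracket of
  \<open>c + 1\<close> factors vanishes when one of them lies in \<open>Z_c\<close>; so \<open>L^(c+1)\<close> is spanned by the
  left-normed brackets of \<open>c + 1\<close> of these elements, and it suffices to find few generators of
  that span.

  They come from Lazard elimination: brackets in an alphabet \<open>Y \<union> {x}\<close> are combinations of \<open>x\<close>
  itself, of \<open>[x, x]\<close> if \<open>x\<close> is odd, and of brackets in the alphabet of all \<open>[..[y, x], .., x]\<close>
  with \<open>y \<in> Y\<close>. Eliminating letters of minimal degree repeatedly exhausts all degrees up to
  \<open>c + 1\<close>. For \<open>s = 1\<close> and for \<open>s = -1\<close>, let \<open>G\<close> be the generating function of the alphabet, a
  letter of degree \<open>d\<close> and parity \<open>p\<close> contributing \<open>s^p X^d\<close>. The elimination of \<open>x\<close> divides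
  \<open>1 - G\<close> by \<open>1 - s^p X^d\<close>. Taking logarithmic derivatives, \<open>(m + s n)^k\<close> becomes a sum over the
  collected elements of degree \<open>d\<close> dividing \<open>k\<close>, of \<open>d\<close> for an even and \<open>- d (-s)^(k/d)\<close> for an
  odd element. With \<open>s = - (-1)^a\<close> and \<open>k = (c+1)/a\<close> these terms do not depend on \<open>a\<close>, and
  Moebius inversion counts the collected elements of degree \<open>c + 1\<close>.
\<close>


section \<open>Moebius inversion\<close>

lemma moebius_prime_mult:
  assumes "prime p" "\<not> p dvd a" "a > 0"
  shows "moebius (p * a) = - moebius a"
proof -
  have cop: "coprime p a" using assms by (simp add: prime_imp_coprime)
  have "squarefree (p * a) \<longleftrightarrow> squarefree a"
    using squarefree_mult_coprime[OF cop] squarefree_prime[OF assms(1)] squarefree_multD(2) by blast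
  moreover have "prime_factors (p * a) = insert p (prime_factors a)"
    using assms by (subst prime_factors_product) (auto simp: prime_prime_factors)
  moreover have "p \<notin> prime_factors a" using assms(2) by auto
  ultimately show ?thesis by (simp add: moebius_def)
qed

text \<open>For a prime \<open>p\<close> dividing \<open>n\<close>, the squarefree divisors of
  \<open>n\<close> pair up as \<open>a\<close> and \<open>p * a\<close> with \<open>p\<close> not
  dividing \<open>a\<close>, and the two members of a pair have opposite \<open>moebius\<close>
  values.\<close>

lemma sum_moebius_divisors:
  assumes "n > 0"
  shows "(\<Sum>a | a dvd n. moebius a) = (if n = 1 then 1 else 0)"
proof (cases "n = 1")
  case True
  then show ?thesis by (simp add: moebius_def)
next
  case False
  then obtain p where p: "prime p" "p dvd n" using prime_factor_nat by blast
  have p0: "p > 0" using p(1) by (rule prime_gt_0_nat)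
  let ?A = "{a. a dvd n \<and> squarefree a \<and> \<not> p dvd a}"
  have fin: "finite {a. a dvd n}" using assms by simp
  have pos: "a > 0" if "a dvd n" for a using that assms by (auto intro: Nat.gr0I)
  have *: "{a. a dvd n \<and> squarefree a} = ?A \<union> (\<lambda>a. p * a) ` ?A"
  proof (intro equalityI subsetI)
    fix a assume a: "a \<in> {a. a dvd n \<and> squarefree a}"
    show "a \<in> ?A \<union> (\<lambda>a. p * a) ` ?A"
    proof (cases "p dvd a")
      case True
      then obtain b where b: "a = p * b" by auto
      have "\<not> p dvd b"
      proof
        assume "p dvd b"
        then have "p\<^sup>2 dvd a" unfolding b power2_eq_square by (rule mult_dvd_mono[OF dvd_refl])
        with a have "is_unit p" unfolding squarefree_def by blast
        with p(1) show False by auto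
      qed
      moreover have "b dvd n" using a b dvd_mult_right by blast
      moreover have "squarefree b" using a b squarefree_multD(2) by blast
      ultimately show ?thesis using b by blast
    qed (use a in auto)
  next
    fix a assume "a \<in> ?A \<union> (\<lambda>a. p * a) ` ?A"
    then show "a \<in> {a. a dvd n \<and> squarefree a}"
    proof
      assume "a \<in> (\<lambda>a. p * a) ` ?A"
      then obtain b where b: "a = p * b" "b dvd n" "squarefree b" "\<not> p dvd b" by blast
      have cop: "coprime p b" using p b by (simp add: prime_imp_coprime)
      have "a dvd n" unfolding b(1) using cop p(2) b(2) by (rule divides_mult[rotated -1])
      moreover have "squarefree a" unfolding b(1)
        using squarefree_mult_coprime[OF cop squarefree_prime[OF p(1)]] b by blast
      ultimately show ?thesis by simp
    qed auto
  qed
  have "(\<Sum>a | a dvd n. moebius a) = (\<Sum>a | a dvd n \<and> squarefree a. moebius a)"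
    by (rule sum.mono_neutral_right) (use fin in \<open>auto simp: moebius_def\<close>)
  also have "\<dots> = (\<Sum>a\<in>?A. moebius a) + (\<Sum>a\<in>(\<lambda>a. p * a) ` ?A. moebius a)"
    unfolding * by (rule sum.union_disjoint) (use fin in auto)
  also have "(\<Sum>a\<in>(\<lambda>a. p * a) ` ?A. moebius a) = (\<Sum>a\<in>?A. moebius (p * a))"
    by (subst sum.reindex) (use p0 in \<open>auto simp: inj_on_def\<close>)
  also have "\<dots> = (\<Sum>a\<in>?A. - moebius a)"
    by (rule sum.cong) (use p(1) pos in \<open>auto intro!: moebius_prime_mult\<close>)
  finally show ?thesis using False by (simp add: sum_negf)
qed

section \<open>Logarithmic derivatives and weights\<close>

text \<open>The minus sign turns coefficients into power sums: a factor \<open>1 - a X\<close>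
  contributes \<open>a ^ k\<close> in each degree \<open>k > 0\<close>.\<close>

definition log_deriv :: "real fps \<Rightarrow> real fps" where
  "log_deriv F = - (fps_X * fps_deriv F * inverse F)"

lemma log_deriv_mult:
  assumes "F $ 0 \<noteq> 0" "G $ 0 \<noteq> 0"
  shows "log_deriv (F * G) = log_deriv F + log_deriv G"
proof -
  have "F * inverse F = 1" "G * inverse G = 1" using assms by (simp_all add: inverse_mult_eq_1')
  moreover have "log_deriv (F * G) = - fps_X * (F * inverse F * (fps_deriv G * inverse G)
      + (fps_deriv F * inverse F) * (G * inverse G))"
    unfolding log_deriv_def fps_deriv_mult fps_inverse_mult by (simp add: algebra_simps)
  ultimately show ?thesis unfolding log_deriv_def by (simp add: algebra_simps)
qed

text \<open>For \<open>F = 1 - a X^d\<close> the series \<open>- X F' / F\<close> is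
  \<open>d a X^d / (1 - a X^d)\<close>, a geometric series.\<close>

lemma log_deriv_one_minus_monom:
  assumes "d > 0" "k > 0"
  shows "log_deriv (1 - fps_const a * fps_X ^ d) $ k = (if d dvd k then real d * a ^ (k div d) else 0)"
proof -
  let ?F = "1 - fps_const a * fps_X ^ d"
  \<comment> \<open>\<open>P\<close> is the expected series, with constant term 0; the identity
    \<open>F * P = - X F'\<close> is checked instead of expanding \<open>inverse F\<close>.\<close>
  define P where "P = Abs_fps (\<lambda>k. if k > 0 \<and> d dvd k then real d * a ^ (k div d) else 0)"
  have XD: "fps_X * fps_deriv ?F = - (fps_const (real d * a) * fps_X ^ d)"
  proof (rule fps_ext)
    fix i
    show "(fps_X * fps_deriv ?F) $ i = (- (fps_const (real d * a) * fps_X ^ d)) $ i"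
      using assms(1) by (cases i) (auto simp: fps_X_power_nth)
  qed
  have "?F * P = fps_const (real d * a) * fps_X ^ d"
  proof (rule fps_ext)
    fix i
    have "(?F * P) $ i = P $ i - a * (if i < d then 0 else P $ (i - d))"
      by (simp add: left_diff_distrib mult.assoc fps_X_power_mult_nth)
    also have "\<dots> = (if i = d then real d * a else 0)"
    proof (cases "i > d")
      case True
      have "d dvd i \<Longrightarrow> i div d = Suc ((i - d) div d)"
        using True assms(1) by (simp add: le_div_geq)
      then show ?thesis using True assms by (auto simp: P_def dvd_minus_self)
    qed (use assms in \<open>auto simp: P_def dest: dvd_imp_le\<close>)
    finally show "(?F * P) $ i = (fps_const (real d * a) * fps_X ^ d) $ i"
      by (simp add: fps_X_power_nth)
  qed
  then have "log_deriv ?F = P * (?F * inverse ?F)"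
    unfolding log_deriv_def XD by (simp add: mult_ac)
  also have "?F * inverse ?F = 1" using assms(1) by (intro inverse_mult_eq_1') simp
  finally show ?thesis using assms by (simp add: P_def)
qed

text \<open>
  The signs make the weights of an odd letter of degree \<open>d\<close> and of its square, which is even of
  degree \<open>2 * d\<close>, add up to \<open>if d dvd k then d * s ^ (k div d) else 0\<close> for \<open>s\<^sup>2 = 1\<close>.
\<close>

definition weight :: "real \<Rightarrow> nat \<Rightarrow> nat \<Rightarrow> bit \<Rightarrow> real" where
  "weight s k d p = (if d dvd k then real d * (if p = 0 then 1 else - ((- s) ^ (k div d))) else 0)"

text \<open>If \<open>N = d * q\<close>, exactly the \<open>a\<close> dividing \<open>q\<close>
  contribute, all with the same weight \<open>C\<close>, so the sum is \<open>C\<close> times the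
  sum of \<open>moebius\<close> over the divisors of \<open>q\<close>.\<close>

lemma sum_moebius_weight:
  assumes "N > 0" "d > 0"
  shows "(\<Sum>a | a dvd N. real_of_int (moebius a) * weight (- ((- 1) ^ a)) (N div a) d p)
    = (if d = N then real N else 0)"
proof (cases "d dvd N")
  case False
  have "weight (- ((- 1) ^ a)) (N div a) d p = 0" if "a dvd N" for a
  proof -
    have "N div a dvd N" using that by (metis dvd_div_mult_self dvd_triv_left)
    then show ?thesis using False dvd_trans by (auto simp: weight_def)
  qed
  then show ?thesis using False by auto
next
  case True
  then obtain q where q: "N = d * q" by auto
  with assms have q0: "q > 0" by (auto intro: Nat.gr0I)
  define C where "C = real d * (if p = 0 then 1 else - ((- 1) ^ q))"
  have 1: "weight (- ((- 1) ^ a)) (N div a) d p = (if a dvd q then C else 0)" if "a dvd N" for a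
  proof -
    have "a > 0" using that assms by (auto intro: Nat.gr0I)
    have "d dvd N div a \<longleftrightarrow> a dvd q"
    proof -
      have "d dvd N div a \<longleftrightarrow> d * a dvd N" using \<open>a > 0\<close> that by (auto elim!: dvdE)
      then show ?thesis using q assms by simp
    qed
    \<comment> \<open>Here \<open>- s = (-1)^a\<close>, and its power with exponent
      \<open>q / a\<close> is \<open>(-1)^q\<close> for every such \<open>a\<close>.\<close>
    moreover have "((- 1::real) ^ a) ^ (N div a div d) = (- 1) ^ q" if aq: "a dvd q"
    proof -
      obtain r where "q = a * r" using aq by auto
      then show ?thesis using q \<open>a > 0\<close> assms by (simp add: power_mult mult_ac)
    qed
    ultimately show ?thesis by (simp add: weight_def C_def)
  qed
  have "(\<Sum>a | a dvd N. real_of_int (moebius a) * weight (- ((- 1) ^ a)) (N div a) d p)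
      = (\<Sum>a | a dvd N. if a dvd q then real_of_int (moebius a) * C else 0)"
    by (rule sum.cong) (auto simp: 1)
  also have "\<dots> = (\<Sum>a | a dvd q. real_of_int (moebius a) * C)"
    using assms q by (intro sum.mono_neutral_cong_right) auto
  also have "\<dots> = real_of_int (\<Sum>a | a dvd q. moebius a) * C"
    by (simp add: sum_distrib_right)
  also have "\<dots> = (if q = 1 then C else 0)" using q0 by (simp add: sum_moebius_divisors)
  \<comment> \<open>For \<open>q = 1\<close>, that is \<open>d = N\<close>, the odd case of
    \<open>C\<close> equals \<open>N\<close> as well, because \<open>- ((-1)^1) = 1\<close>.\<close>
  finally show ?thesis using q assms by (auto simp: C_def)
qed

lemma moebius_count:
  assumes "N > 0" "\<And>d p v. (d, p, v) \<in> set E \<Longrightarrow> d > 0"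
  shows "(\<Sum>a | a dvd N. real_of_int (moebius a) *
      (\<Sum>(d, p, v) \<leftarrow> E. weight (- ((- 1) ^ a)) (N div a) d p))
    = real N * real (length (filter (\<lambda>t. fst t = N) E))"
  using assms(2)
proof (induction E)
  case (Cons t E)
  obtain d p v where t: "t = (d, p, v)" by (cases t)
  then have "d > 0" using Cons.prems[of d p v] by simp
  have "(\<Sum>a | a dvd N. real_of_int (moebius a) *
      (\<Sum>(d, p, v) \<leftarrow> t # E. weight (- ((- 1) ^ a)) (N div a) d p))
    = (\<Sum>a | a dvd N. real_of_int (moebius a) * weight (- ((- 1) ^ a)) (N div a) d p)
      + (\<Sum>a | a dvd N. real_of_int (moebius a) *
      (\<Sum>(d, p, v) \<leftarrow> E. weight (- ((- 1) ^ a)) (N div a) d p))"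
    by (simp add: t distrib_left sum.distrib)
  also have "\<dots> = (if d = N then real N else 0) + real N * real (length (filter (\<lambda>t. fst t = N) E))"
    using Cons.prems by (subst Cons.IH) (auto simp: sum_moebius_weight[OF assms(1) \<open>d > 0\<close>])
  finally show ?case by (simp add: t algebra_simps)
qed simp

section \<open>Lazard elimination in a Lie superalgebra\<close>

text \<open>A letter is a triple of degree, parity and value.\<close>

inductive_set monomials :: "('v \<Rightarrow> 'v \<Rightarrow> 'v) \<Rightarrow> (nat \<times> bit \<times> 'v) set \<Rightarrow> (nat \<times> bit \<times> 'v) set"
  for f :: "'v \<Rightarrow> 'v \<Rightarrow> 'v" and X :: "(nat \<times> bit \<times> 'v) set" where
  letter: "(d, p, v) \<in> X \<Longrightarrow> (d, p, v) \<in> monomials f X"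
| snoc: "(d, p, v) \<in> monomials f X \<Longrightarrow> (e, q, w) \<in> X \<Longrightarrow> (d + e, p + q, f v w) \<in> monomials f X"

text \<open>The right factor is the first argument, so that \<open>times_letter f x ^^ k\<close> is
  \<open>k\<close>-fold right multiplication by \<open>x\<close>.\<close>

fun times_letter :: "('v \<Rightarrow> 'v \<Rightarrow> 'v) \<Rightarrow> nat \<times> bit \<times> 'v \<Rightarrow> nat \<times> bit \<times> 'v \<Rightarrow> nat \<times> bit \<times> 'v" where
  "times_letter f (e, q, w) (d, p, v) = (d + e, p + q, f v w)"

definition layer :: "nat \<Rightarrow> (nat \<times> bit \<times> 'v) set \<Rightarrow> 'v set" where
  "layer n M = {v. \<exists>p. (n, p, v) \<in> M}"

lemma layerI: "(n, p, v) \<in> M \<Longrightarrow> v \<in> layer n M"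
  by (auto simp: layer_def)

lemma layer_mono: "M \<subseteq> M' \<Longrightarrow> layer n M \<subseteq> layer n M'"
  by (auto simp: layer_def)

lemma layer_Un: "layer n (M \<union> M') = layer n M \<union> layer n M'"
  by (auto simp: layer_def)

lemma monomials_deg_ge:
  assumes "(n, p, v) \<in> monomials f X" "\<And>d p v. (d, p, v) \<in> X \<Longrightarrow> d \<ge> k"
  shows "n \<ge> k"
  using assms(1) by (induction rule: monomials.induct) (use assms(2) trans_le_add1 in blast)+

text \<open>Degrees add up along a monomial, so each letter of a monomial of degree at most
  \<open>N\<close> has degree at most \<open>N\<close>. This lets infinite alphabets be replaced by
  finite ones.\<close>

lemma monomials_truncate:
  assumes "(n, p, v) \<in> monomials f X" "n \<le> N" "\<And>d p v. (d, p, v) \<in> X \<Longrightarrow> d \<le> N \<Longrightarrow> (d, p, v) \<in> X'"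
  shows "(n, p, v) \<in> monomials f X'"
  using assms(1,2)
proof (induction rule: monomials.induct)
  case (letter d p v)
  then show ?case by (intro monomials.letter assms(3))
next
  case (snoc d p v e q w)
  then show ?case by (intro monomials.snoc assms(3)) simp_all
qed

section \<open>Bilinearity and consequences of the super Jacobi identity\<close>

context lie_superalgebra
begin

lemma module_hom_bracket:
  shows "module_hom scale scale (bracket x)" "module_hom scale scale (\<lambda>x. bracket x y)"
  using linear_bracket_right[of x] linear_bracket_left[of y]
  by (simp_all add: Vector_Spaces.linear_iff_module_hom)

lemmas bracket_add_right = module_hom.add[OF module_hom_bracket(1)]
  and bracket_add_left = module_hom.add[OF module_hom_bracket(2)]
  and bracket_scale_right = module_hom.scale[OF module_hom_bracket(1)]
  and bracket_scale_left = module_hom.scale[OF module_hom_bracket(2)]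
  and bracket_zero_right = module_hom.zero[OF module_hom_bracket(1)]
  and bracket_zero_left = module_hom.zero[OF module_hom_bracket(2)]
  and bracket_minus_right = module_hom.neg[OF module_hom_bracket(1)]

lemma bracket_span_left:
  assumes "v \<in> span A" "\<And>a. a \<in> A \<Longrightarrow> bracket a w \<in> span B"
  shows "bracket v w \<in> span B"
  using assms(1)
  by (induction rule: span_induct_alt)
     (auto simp: bracket_zero_left bracket_add_left bracket_scale_left
       intro!: span_add span_scale span_zero assms(2))

lemma bracket_span_right:
  assumes "w \<in> span A" "\<And>a. a \<in> A \<Longrightarrow> bracket v a \<in> span B"
  shows "bracket v w \<in> span B"
  using assms(1)
  by (induction rule: span_induct_alt)
     (auto simp: bracket_zero_right bracket_add_right bracket_scale_right
       intro!: span_add span_scale span_zero assms(2))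

lemma sign_sign: "sign \<alpha> \<beta> *s sign \<alpha> \<beta> *s x = x"
  by (simp add: sign_def)

text \<open>This is the Jacobi identity read as a Leibniz rule: right multiplication by
  \<open>c\<close> is a superderivation. The signs are compared in all eight parity cases.\<close>

lemma bracket_bracket:
  assumes a: "a \<in> part \<alpha>" and b: "b \<in> part \<beta>" and c: "c \<in> part \<gamma>"
  shows "bracket (bracket a b) c = bracket a (bracket b c) + sign \<beta> \<gamma> *s bracket (bracket a c) b"
proof -
  have 1: "bracket c (bracket a b) = - (sign \<gamma> (\<alpha> + \<beta>) *s bracket (bracket a b) c)"
    by (rule super_antisym[OF c bracket_part[OF a b]])
  have 2: "bracket b (bracket c a) = sign \<gamma> \<alpha> *s sign \<beta> (\<alpha> + \<gamma>) *s bracket (bracket a c) b"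
    unfolding super_antisym[OF c a] bracket_minus_right bracket_scale_right
      super_antisym[OF b bracket_part[OF a c]] by simp
  \<comment> \<open>Multiplying by \<open>sign \<alpha> \<gamma>\<close>, which is its own inverse,
    isolates the first Jacobi term.\<close>
  have "bracket a (bracket b c) =
      sign \<alpha> \<gamma> *s (sign \<gamma> \<beta> *s sign \<gamma> (\<alpha> + \<beta>) *s bracket (bracket a b) c
        - sign \<beta> \<alpha> *s sign \<gamma> \<alpha> *s sign \<beta> (\<alpha> + \<gamma>) *s bracket (bracket a c) b)"
    using arg_cong[OF super_jacobi[OF a b c], of "\<lambda>x. sign \<alpha> \<gamma> *s x"]
    unfolding 1 2 by (simp add: scale_right_distrib scale_right_diff_distrib sign_sign algebra_simps
       eq_neg_iff_add_eq_0 del: scale_scale)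
  then show ?thesis
    by (cases \<alpha>; cases \<beta>; cases \<gamma>) (simp_all add: sign_def)
qed

lemma bracket_self_even:
  assumes "(2::'k) \<noteq> 0" "x \<in> part 0"
  shows "bracket x x = 0"
proof -
  have "bracket x x = - bracket x x"
    using super_antisym[OF assms(2,2)] by (simp add: sign_def)
  then have "bracket x x + bracket x x = 0" by (metis add.right_inverse)
  then have "(2::'k) *s bracket x x = 0" by (metis one_add_one scale_left_distrib scale_one)
  then show ?thesis using assms(1) by simp
qed

text \<open>For three equal odd arguments the Jacobi terms coincide and leave
  \<open>- 3 [x, [x, x]] = 0\<close>.\<close>

lemma bracket_bracket_self_odd:
  assumes "(3::'k) \<noteq> 0" "x \<in> part 1"
  shows "bracket (bracket x x) x = 0"
proof -
  let ?w = "bracket x (bracket x x)"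
  have "- ?w - ?w - ?w = 0"
    using super_jacobi[OF assms(2,2,2)] by (simp add: sign_def)
  moreover have "(3::'k) *s ?w = ?w + ?w + ?w"
    by (metis numeral_3_eq_3 one_add_one scale_left_distrib scale_one numeral_Bit1 numeral_One)
  ultimately have "(3::'k) *s ?w = 0"
    by (metis (no_types) add.inverse_neutral diff_conv_add_uminus minus_add_distrib minus_minus)
  then have "?w = 0" using assms(1) by simp
  then show ?thesis using super_antisym[OF bracket_part[OF assms(2,2)] assms(2)] by simp
qed

definition homogeneous :: "(nat \<times> bit \<times> 'v) set \<Rightarrow> bool" where
  "homogeneous X \<longleftrightarrow> (\<forall>(d, p, v)\<in>X. v \<in> part p)"

lemma homogeneousD: "homogeneous X \<Longrightarrow> (d, p, v) \<in> X \<Longrightarrow> v \<in> part p"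
  by (auto simp: homogeneous_def)

lemma monomials_part:
  assumes "(n, p, v) \<in> monomials bracket X" "homogeneous X"
  shows "v \<in> part p"
  using assms(1)
proof (induction rule: monomials.induct)
  case (snoc d p v e q w)
  then show ?case using homogeneousD[OF assms(2)] bracket_part by blast
qed (rule homogeneousD[OF assms(2)])

lemma bracket_layer_snoc:
  assumes "v \<in> span (layer n (monomials bracket X))" "(d, p, w) \<in> X"
  shows "bracket v w \<in> span (layer (n + d) (monomials bracket X))"
  using assms by (elim bracket_span_left) (auto simp: layer_def intro!: span_base monomials.snoc)


section \<open>Elimination of a single letter\<close>

definition eliminate :: "nat \<times> bit \<times> 'v \<Rightarrow> (nat \<times> bit \<times> 'v) set \<Rightarrow> (nat \<times> bit \<times> 'v) set" where
  "eliminate x Y = {(times_letter bracket x ^^ k) y |k y. y \<in> Y}"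

lemma subset_eliminate: "Y \<subseteq> eliminate x Y"
proof
  fix y assume "y \<in> Y"
  then show "y \<in> eliminate x Y" unfolding eliminate_def
    by (intro CollectI exI[of _ "0::nat"] exI[of _ y]) simp
qed

lemma eliminate_times:
  assumes "(e, q, w) \<in> eliminate (d, p, x) Y"
  shows "(e + d, q + p, bracket w x) \<in> eliminate (d, p, x) Y"
proof -
  obtain k y where y: "(e, q, w) = (times_letter bracket (d, p, x) ^^ k) y" "y \<in> Y"
    using assms unfolding eliminate_def by blast
  have "(e + d, q + p, bracket w x) = (times_letter bracket (d, p, x) ^^ Suc k) y"
    by (simp add: y(1)[symmetric])
  then show ?thesis using y(2) unfolding eliminate_def by blast
qed

lemma homogeneous_eliminate:
  assumes "x \<in> part p" "homogeneous Y"
  shows "homogeneous (eliminate (d, p, x) Y)"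
proof -
  have *: "homogeneous {(times_letter bracket (d, p, x) ^^ k) y}" if "y \<in> Y" for k y
  proof (induction k)
    case 0
    then show ?case using that assms(2) by (auto simp: homogeneous_def)
  next
    case (Suc k)
    obtain e q w where "(times_letter bracket (d, p, x) ^^ k) y = (e, q, w)" by (metis prod_cases3)
    with Suc show ?case using bracket_part[OF _ assms(1)] by (simp add: homogeneous_def)
  qed
  show ?thesis unfolding homogeneous_def
  proof
    fix z assume "z \<in> eliminate (d, p, x) Y"
    then obtain k y where "z = (times_letter bracket (d, p, x) ^^ k) y" "y \<in> Y"
      unfolding eliminate_def by blast
    then show "case z of (d, p, v) \<Rightarrow> v \<in> part p" using *[of y k] by (simp add: homogeneous_def)
  qed
qed

text \<open>Right multiplication by \<open>x\<close> is a superderivation that sends each letter of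
  the new alphabet to another letter, so it maps monomials to combinations of monomials.\<close>

lemma eliminate_derivation:
  assumes x: "x \<in> part p" and Y: "homogeneous Y"
    and v: "(n, q, v) \<in> monomials bracket (eliminate (d, p, x) Y)"
  shows "bracket v x \<in> span (layer (n + d) (monomials bracket (eliminate (d, p, x) Y)))"
  using v
proof (induction rule: monomials.induct)
  case (letter e q w)
  show ?case by (rule span_base[OF layerI[OF monomials.letter[OF eliminate_times[OF letter]]]])
next
  case (snoc n q v e r w)
  let ?Z = "eliminate (d, p, x) Y"
  have Z: "homogeneous ?Z" using x Y by (rule homogeneous_eliminate)
  have "v \<in> part q" using monomials_part[OF snoc.hyps(1) Z] .
  then have "bracket (bracket v w) x = bracket v (bracket w x) + sign r p *s bracket (bracket v x) w"
    using bracket_bracket[OF _ homogeneousD[OF Z snoc.hyps(2)] x] by blast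
  moreover have "bracket v (bracket w x) \<in> span (layer (n + (e + d)) (monomials bracket ?Z))"
    by (rule span_base[OF layerI[OF monomials.snoc[OF snoc.hyps(1) eliminate_times[OF snoc.hyps(2)]]]])
  moreover have "bracket (bracket v x) w \<in> span (layer (n + d + e) (monomials bracket ?Z))"
    by (rule bracket_layer_snoc[OF snoc.IH snoc.hyps(2)])
  ultimately show ?case by (simp add: add_ac span_add span_scale)
qed

text \<open>These elements span the subalgebra generated by \<open>x\<close>: in characteristic
  other than 2 and 3, \<open>[x, x]\<close> vanishes for even \<open>x\<close> and
  \<open>[[x, x], x]\<close> for odd \<open>x\<close>.\<close>

definition residue :: "nat \<times> bit \<times> 'v \<Rightarrow> (nat \<times> bit \<times> 'v) list" where
  "residue = (\<lambda>(d, p, x). (d, p, x) # (if p = 1 then [(2 * d, 0, bracket x x)] else []))"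

lemma residue_times:
  assumes char: "(2::'k) \<noteq> 0" "(3::'k) \<noteq> 0" and x: "x \<in> part p"
    and y: "(e, q, y) \<in> Y" "y \<in> part q" and s: "(n, r, s) \<in> set (residue (d, p, x))"
  shows "bracket s y \<in> span (layer (n + e) (monomials bracket (eliminate (d, p, x) Y)))"
proof -
  let ?M = "monomials bracket (eliminate (d, p, x) Y)"
  have yZ: "(e, q, y) \<in> eliminate (d, p, x) Y" using y(1) subset_eliminate by blast
  note yx = eliminate_times[OF yZ]
  have 1: "bracket x y \<in> span (layer (d + e) ?M)"
    unfolding super_antisym[OF x y(2)]
    by (intro span_neg span_scale span_base layerI[of _ "q + p"])
       (use monomials.letter[OF yx] in \<open>simp add: add.commute\<close>)
  have 2: "bracket (bracket x x) y \<in> span (layer (2 * d + e) ?M)" if "p = 1"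
  proof -
    \<comment> \<open>For odd \<open>x\<close> the Leibniz rule gives
      \<open>[y, [x, x]] = 2 [[y, x], x]\<close>, a multiple of a letter of the new
      alphabet.\<close>
    have "bracket (bracket y x) x = bracket y (bracket x x) - bracket (bracket y x) x"
      using bracket_bracket[OF y(2) x x] that by (simp add: sign_def)
    then have "bracket y (bracket x x) = bracket (bracket y x) x + bracket (bracket y x) x"
      by (simp add: algebra_simps)
    moreover have "bracket (bracket y x) x \<in> span (layer (2 * d + e) ?M)"
      using span_base[OF layerI[OF monomials.letter[OF eliminate_times[OF yx]]]]
      by (simp add: add_ac mult_2)
    ultimately show ?thesis
      unfolding super_antisym[OF bracket_part[OF x x] y(2)]
      by (intro span_neg span_scale) (simp add: span_add)
  qed
  show "bracket s y \<in> span (layer (n + e) ?M)"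
    using s 1 2 by (auto simp: residue_def split: if_splits)
qed

lemma residue_times_self:
  assumes char: "(2::'k) \<noteq> 0" "(3::'k) \<noteq> 0" and x: "x \<in> part p"
    and s: "(n, r, s) \<in> set (residue (d, p, x))"
  shows "bracket s x \<in> span (layer (n + d) (set (residue (d, p, x))))"
proof (cases "p = 1")
  case True
  then have z: "bracket (bracket x x) x = 0" using x bracket_bracket_self_odd[OF char(2)] by simp
  have "bracket x x \<in> span (layer (d + d) (set (residue (d, p, x))))"
    by (rule span_base) (use True in \<open>auto simp: residue_def layer_def mult_2\<close>)
  then show ?thesis using s True z by (auto simp: residue_def span_zero)
next
  case False
  then have "p = 0" by simp
  then show ?thesis using s x bracket_self_even[OF char(1)]
    by (auto simp: residue_def span_zero)
qed

text \<open>The span of new monomials and residue contains the old letters and is closed under right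
  multiplication by each of them. The four cases are: monomial or residue, times a letter of
  \<open>Y\<close> or \<open>x\<close>.\<close>

lemma elimination:
  assumes char: "(2::'k) \<noteq> 0" "(3::'k) \<noteq> 0" and x: "x \<in> part p"
    and Y: "homogeneous Y"
    and v: "(n, q, v) \<in> monomials bracket (insert (d, p, x) Y)"
  shows "v \<in> span (layer n (monomials bracket (eliminate (d, p, x) Y) \<union> set (residue (d, p, x))))"
    (is "v \<in> span (layer n (?M \<union> ?R))")
  using v
proof (induction rule: monomials.induct)
  case (letter e q w)
  then have "(e, q, w) \<in> ?M \<union> ?R"
    using subset_eliminate[of Y] by (auto simp: residue_def intro!: monomials.letter)
  then show ?case by (intro span_base layerI)
next
  case (snoc n q v e r w)
  show ?case
  proof (rule bracket_span_left[OF snoc.IH])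
    fix a assume "a \<in> layer n (?M \<union> ?R)"
    then consider s where "(n, s, a) \<in> ?M" | s where "(n, s, a) \<in> ?R" by (auto simp: layer_def)
    moreover have M: "span (layer (n + e) ?M) \<subseteq> span (layer (n + e) (?M \<union> ?R))"
      and R: "span (layer (n + e) ?R) \<subseteq> span (layer (n + e) (?M \<union> ?R))"
      by (intro span_mono layer_mono; simp)+
    ultimately show "bracket a w \<in> span (layer (n + e) (?M \<union> ?R))"
    proof cases
      case 1
      show ?thesis
      \<comment> \<open>The split is by membership in \<open>Y\<close>, since a copy of the
        eliminated letter may itself lie in \<open>Y\<close>.\<close>
      proof (cases "(e, r, w) \<in> Y")
        case True
        then have "(n + e, s + r, bracket a w) \<in> ?M"
          using 1 subset_eliminate by (blast intro: monomials.snoc)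
        then show ?thesis by (intro span_base layerI) blast
      next
        case False
        then have "e = d" "w = x" using snoc.hyps(2) by auto
        then show ?thesis using eliminate_derivation[OF x Y 1] M by blast
      qed
    next
      case 2
      show ?thesis
      proof (cases "(e, r, w) \<in> Y")
        case True
        then show ?thesis using residue_times[OF char x True homogeneousD[OF Y True] 2] M by blast
      next
        case False
        then have "e = d" "w = x" using snoc.hyps(2) by auto
        then show ?thesis using residue_times_self[OF char x 2] R by blast
      qed
    qed
  qed
qed

end

section \<open>Counting the eliminated letters\<close>

definition letter_fps :: "real \<Rightarrow> nat \<times> bit \<times> 'v \<Rightarrow> real fps" where
  "letter_fps s = (\<lambda>(d, p, v). fps_const (if p = 0 then 1 else s) * fps_X ^ d)"

text \<open>For \<open>s * s = 1\<close> the sign attached to a parity is multiplicative on the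
  integers modulo 2, so \<open>letter_fps s\<close> turns brackets into products.\<close>

lemma letter_fps_times_letter:
  assumes "s * s = 1"
  shows "letter_fps s ((times_letter f x ^^ k) y) = letter_fps s y * letter_fps s x ^ k"
proof (induction k)
  case (Suc k)
  have "letter_fps s (times_letter f x z) = letter_fps s z * letter_fps s x" for z
  proof -
    obtain d p v where z: "z = (d, p, v)" by (cases z)
    obtain e q w where x: "x = (e, q, w)" by (cases x)
    have "fps_const (if p + q = 0 then 1 else s)
        = fps_const (if p = 0 then 1 else s) * fps_const (if q = 0 then 1 else s)"
      using assms by (cases p; cases q) simp_all
    then show ?thesis
      by (simp only: letter_fps_def z x times_letter.simps prod.case power_add mult_ac)
  qed
  then show ?case using Suc by (simp add: mult_ac)
qed simp

text \<open>A list keeps multiplicities, which the generating function has to count. If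
  \<open>x\<close> has positive degree, the omitted exponents \<open>k > N\<close> only give letters
  of degree above \<open>N\<close>.\<close>

definition elim_list :: "('v \<Rightarrow> 'v \<Rightarrow> 'v) \<Rightarrow> nat \<Rightarrow> nat \<times> bit \<times> 'v \<Rightarrow> (nat \<times> bit \<times> 'v) list \<Rightarrow>
    (nat \<times> bit \<times> 'v) list" where
  "elim_list f N x Y = concat (map (\<lambda>y. map (\<lambda>k. (times_letter f x ^^ k) y) [0..<Suc N]) Y)"

lemma sum_list_letter_fps_elim_list:
  assumes "s * s = 1"
  shows "(\<Sum>z\<leftarrow>elim_list f N x Y. letter_fps s z)
    = (\<Sum>y\<leftarrow>Y. letter_fps s y) * (\<Sum>k<Suc N. letter_fps s x ^ k)"
proof (induction Y)
  case (Cons y Y)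
  have "(\<Sum>k\<leftarrow>[0..<Suc N]. letter_fps s ((times_letter f x ^^ k) y))
      = letter_fps s y * (\<Sum>k<Suc N. letter_fps s x ^ k)"
    unfolding letter_fps_times_letter[OF assms] sum_list_const_mult interv_sum_list_conv_sum_set_nat
    by (simp add: atLeast0LessThan)
  moreover have "(\<Sum>z\<leftarrow>elim_list f N x (y # Y). letter_fps s z)
      = (\<Sum>k\<leftarrow>[0..<Suc N]. letter_fps s ((times_letter f x ^^ k) y))
        + (\<Sum>z\<leftarrow>elim_list f N x Y. letter_fps s z)"
    unfolding elim_list_def by (simp add: comp_def del: upt_Suc)
  ultimately show ?case using Cons by (simp only: sum_list.Cons list.map distrib_right)
qed (simp add: elim_list_def)

lemma fps_mult_nth_eq_0:
  assumes "\<And>i. i \<le> N \<Longrightarrow> (A :: real fps) $ i = 0" "i \<le> N"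
  shows "(A * B) $ i = 0"
  using assms by (simp add: fps_mult_nth)

text \<open>Dividing \<open>1 - l - G\<close> by \<open>1 - l\<close> gives
  \<open>1 - G / (1 - l)\<close>. Up to degree \<open>N\<close>, the inverse of \<open>1 - l\<close>
  is the finite geometric sum produced by \<open>elim_list\<close>.\<close>

lemma elim_list_fps:
  assumes s: "s * s = 1" and d: "d > 0"
    and F: "\<And>i. i \<le> N \<Longrightarrow> F $ i = (1 - letter_fps s (d, p, x) - (\<Sum>y\<leftarrow>Y. letter_fps s y)) $ i"
    and i: "i \<le> N"
  shows "(F * inverse (1 - letter_fps s (d, p, x))) $ i
    = (1 - (\<Sum>z\<leftarrow>elim_list f N (d, p, x) Y. letter_fps s z)) $ i"
proof -
  define l where "l = letter_fps s (d, p, x)"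
  define G where "G = (\<Sum>y\<leftarrow>Y. letter_fps s y)"
  define G' where "G' = (\<Sum>z\<leftarrow>elim_list f N (d, p, x) Y. letter_fps s z)"
  have l0: "(1 - l) $ 0 \<noteq> 0" using d by (simp add: l_def letter_fps_def)
  have G': "(1 - l) * G' = G * (1 - l ^ Suc N)"
    unfolding G'_def G_def l_def sum_list_letter_fps_elim_list[OF s] one_diff_power_eq
    by (simp only: mult_ac)
  have "l ^ Suc N = fps_const ((if p = 0 then 1 else s) ^ Suc N) * fps_X ^ (d * Suc N)"
    unfolding l_def letter_fps_def
    by (simp only: prod.case power_mult_distrib fps_const_power power_mult)
  then have lN: "(l ^ Suc N) $ j = 0" if "j \<le> N" for j
  proof -
    have "j < d * Suc N" using that d mult_le_mono1[of 1 d "Suc N"] by simp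
    then show ?thesis by (simp add: \<open>l ^ Suc N = _\<close> fps_X_power_nth del: power_Suc)
  qed
  \<comment> \<open>The error consists of the deviation of \<open>F\<close> from
    \<open>1 - l - G\<close> and the tail of the geometric sum; both vanish up to degree
    \<open>N\<close>.\<close>
  have *: "F - (1 - l) * (1 - G') = (F - (1 - l - G)) - l ^ Suc N * G"
    using G' by (simp add: algebra_simps)
  have "(F - (1 - l) * (1 - G')) $ j = 0" if "j \<le> N" for j
    unfolding * fps_sub_nth[of "F - _"] fps_sub_nth[of F]
    using F[OF that] fps_mult_nth_eq_0[of N "l ^ Suc N" j G, OF lN that] unfolding l_def G_def
    by simp
  then have "((F - (1 - l) * (1 - G')) * inverse (1 - l)) $ i = 0"
    by (rule fps_mult_nth_eq_0) (use i in auto)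
  moreover have "(F - (1 - l) * (1 - G')) * inverse (1 - l)
      = F * inverse (1 - l) - (1 - G') * ((1 - l) * inverse (1 - l))"
    by (simp add: algebra_simps)
  ultimately show ?thesis using inverse_mult_eq_1'[OF l0]
    by (simp add: l_def G'_def)
qed

lemma fst_times_letter: "fst ((times_letter f x ^^ k) y) = fst y + k * fst x"
proof (induction k)
  case (Suc k)
  have "fst (times_letter f x z) = fst z + fst x" for z by (cases x; cases z) simp
  then show ?case using Suc by simp
qed simp

lemma elim_list_degree:
  assumes "\<forall>y\<in>set Y. m \<le> fst y" "z \<in> set (elim_list f N x Y)"
  shows "m \<le> fst z"
  using assms by (auto simp: elim_list_def fst_times_letter trans_le_add1)

text \<open>Only \<open>k = 0\<close> keeps degree \<open>m\<close>, as each multiplication by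
  \<open>x\<close> raises the degree. Hence eliminating one letter of minimal degree
  \<open>m\<close> leaves one fewer of that degree.\<close>

lemma length_filter_elim_list:
  assumes "\<forall>y\<in>set Y. m \<le> fst y" "fst x > 0"
  shows "length (filter (\<lambda>z. fst z = m) (elim_list f N x Y)) = length (filter (\<lambda>y. fst y = m) Y)"
  using assms(1)
proof (induction Y)
  case (Cons y Y)
  have upt: "[0..<Suc N] = 0 # [1..<Suc N]" by (simp add: upt_conv_Cons del: upt_Suc)
  have "filter (\<lambda>z. fst z = m) (map (\<lambda>k. (times_letter f x ^^ k) y) [1..<Suc N]) = []"
    using Cons.prems assms(2) by (auto simp: filter_empty_conv fst_times_letter simp del: upt_Suc)
  then show ?case using Cons unfolding elim_list_def
    by (simp add: upt del: upt_Suc)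
qed (simp add: elim_list_def)

section \<open>Exhausting all degrees up to \<open>N\<close> by repeated elimination\<close>

context lie_superalgebra
begin

lemma log_deriv_residue:
  assumes "s * s = 1" "d > 0" "k > 0"
  shows "log_deriv (1 - letter_fps s (d, p, x)) $ k = (\<Sum>(d, p, v)\<leftarrow>residue (d, p, x). weight s k d p)"
proof -
  have l: "log_deriv (1 - letter_fps s (d, p, x)) $ k
      = (if d dvd k then real d * (if p = 0 then 1 else s) ^ (k div d) else 0)"
    using log_deriv_one_minus_monom[OF assms(2,3)] by (simp add: letter_fps_def)
  show ?thesis
  proof (cases "p = 1 \<and> d dvd k")
    case True
    then obtain j where j: "k = d * j" by auto
    \<comment> \<open>For even \<open>j\<close> the odd letter gives \<open>- d\<close> and its
      square \<open>2 * d\<close>, in total \<open>d = d * s ^ j\<close>. For odd \<open>j\<close>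
      the letter alone gives \<open>d * s ^ j\<close>, as \<open>2 * d\<close> does not divide
      \<open>k\<close>.\<close>
    have "2 * d dvd k \<longleftrightarrow> even j" using j assms(2) by (simp add: mult.commute[of 2 d])
    moreover have "s ^ j = 1" if "even j"
      using that assms(1) by (auto elim!: evenE simp: power_mult power2_eq_square)
    moreover have "(- s) ^ j = - (s ^ j)" if "odd j" using that by simp
    moreover have "log_deriv (1 - letter_fps s (d, p, x)) $ k = real d * s ^ j"
      using True j assms(2) l by simp
    ultimately show ?thesis using True j assms(2)
      by (auto simp: residue_def weight_def)
  next
    case False
    moreover have "\<not> 2 * d dvd k" if "\<not> d dvd k" using that dvd_mult_right by blast
    ultimately show ?thesis by (auto simp: l residue_def weight_def)
  qed
qed

lemma eliminate_elim_list:
  assumes "z \<in> eliminate x (set Y)" "fst z \<le> N" "fst x > 0"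
  shows "z \<in> set (elim_list bracket N x Y)"
proof -
  obtain k y where z: "z = (times_letter bracket x ^^ k) y" "y \<in> set Y"
    using assms(1) unfolding eliminate_def by blast
  have "k * 1 \<le> k * fst x" using assms(3) by (intro mult_le_mono2) simp
  also have "\<dots> \<le> N" using assms(2) by (simp add: z fst_times_letter)
  finally show ?thesis using z unfolding elim_list_def
    by (auto intro!: bexI[of _ y] image_eqI[of _ _ k] simp del: upt_Suc)
qed

lemma elim_list_subset: "set (elim_list bracket N x Y) \<subseteq> eliminate x (set Y)"
  by (auto simp: elim_list_def eliminate_def)

lemma homogeneous_subset: "homogeneous X \<Longrightarrow> Y \<subseteq> X \<Longrightarrow> homogeneous Y"
  by (auto simp: homogeneous_def)

text \<open>
  \<open>F\<close> need only agree with \<open>1 - G\<close> up to degree \<open>N\<close>, because \<open>elim_list\<close> keeps the alphabet finite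
  by dropping only letters of degree above \<open>N\<close>.
\<close>

definition exhausts :: "nat \<Rightarrow> (nat \<times> bit \<times> 'v) list \<Rightarrow> (nat \<times> bit \<times> 'v) list \<Rightarrow> bool" where
  "exhausts N X E \<longleftrightarrow> (\<forall>z\<in>set E. fst z > 0)
    \<and> layer N (monomials bracket (set X)) \<subseteq> span (layer N (set E))
    \<and> (\<forall>s F k. s * s = 1 \<longrightarrow> (\<forall>i\<le>N. F $ i = (1 - (\<Sum>x\<leftarrow>X. letter_fps s x)) $ i) \<longrightarrow> 0 < k \<longrightarrow> k \<le> N
        \<longrightarrow> log_deriv F $ k = (\<Sum>(d, p, v)\<leftarrow>E. weight s k d p))"

text \<open>There are no monomials of degree \<open>N\<close>, and \<open>F\<close> agrees with 1 up
  to degree \<open>N\<close>, so its logarithmic derivative vanishes there.\<close>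

lemma exhausts_Nil:
  assumes "\<forall>x\<in>set X. N < fst x"
  shows "exhausts N X []"
  unfolding exhausts_def
proof (intro conjI allI impI)
  have "layer N (monomials bracket (set X)) = {}"
    using monomials_deg_ge[of N _ _ bracket "set X" "Suc N"] assms by (force simp: layer_def)
  then show "layer N (monomials bracket (set X)) \<subseteq> span (layer N (set []))" by simp
next
  fix s F k assume F: "\<forall>i\<le>N. F $ i = (1 - (\<Sum>x\<leftarrow>X. letter_fps s x)) $ i" and k: "k \<le> N"
  have "(\<Sum>x\<leftarrow>X. letter_fps s x) $ i = 0" if "i \<le> N" for i
    using assms that by (induction X) (auto simp: letter_fps_def fps_X_power_nth)
  with F have "(fps_X * fps_deriv F) $ i = 0" if "i \<le> N" for i
    using that by (cases i) auto
  then have "(fps_X * fps_deriv F * inverse F) $ k = 0"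
    using k by (rule fps_mult_nth_eq_0)
  then show "log_deriv F $ k = (\<Sum>(d, p, v)\<leftarrow>[]. weight s k d p)" by (simp add: log_deriv_def)
qed simp

text \<open>The spanning part is \<open>elimination\<close> followed by truncation at degree
  \<open>N\<close>. For the series part, \<open>F\<close> is written as
  \<open>1 - letter_fps s (d, p, x)\<close> times a quotient, and \<open>log_deriv\<close> turns
  this product into a sum.\<close>

lemma exhausts_eliminate:
  assumes char: "(2::'k) \<noteq> 0" "(3::'k) \<noteq> 0" and hom: "homogeneous (set (xs @ (d, p, x) # ys))"
    and pos: "\<forall>z\<in>set (xs @ (d, p, x) # ys). fst z > 0"
    and E: "exhausts N (elim_list bracket N (d, p, x) (xs @ ys)) E"
  shows "exhausts N (xs @ (d, p, x) # ys) (residue (d, p, x) @ E)"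
  unfolding exhausts_def
proof (intro conjI allI impI)
  have d: "d > 0" using pos by simp
  then show "\<forall>z\<in>set (residue (d, p, x) @ E). 0 < fst z"
    using E by (auto simp: residue_def exhausts_def)
  let ?Y = "set (xs @ ys)"
  have x: "x \<in> part p" and Y: "homogeneous ?Y" using hom by (auto simp: homogeneous_def)
  have "layer N (monomials bracket (eliminate (d, p, x) ?Y))
      \<subseteq> layer N (monomials bracket (set (elim_list bracket N (d, p, x) (xs @ ys))))"
  proof
    fix v assume "v \<in> layer N (monomials bracket (eliminate (d, p, x) ?Y))"
    then obtain q where "(N, q, v) \<in> monomials bracket (eliminate (d, p, x) ?Y)"
      by (auto simp: layer_def)
    then have "(N, q, v) \<in> monomials bracket (set (elim_list bracket N (d, p, x) (xs @ ys)))"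
    proof (rule monomials_truncate[OF _ order_refl])
      fix e r w assume "(e, r, w) \<in> eliminate (d, p, x) ?Y" "e \<le> N"
      then show "(e, r, w) \<in> set (elim_list bracket N (d, p, x) (xs @ ys))"
        using d by (intro eliminate_elim_list) simp_all
    qed
    then show "v \<in> layer N (monomials bracket (set (elim_list bracket N (d, p, x) (xs @ ys))))"
      by (rule layerI)
  qed
  also have "\<dots> \<subseteq> span (layer N (set E))" using E by (simp add: exhausts_def)
  also have "\<dots> \<subseteq> span (layer N (set (residue (d, p, x) @ E)))"
    by (intro span_mono layer_mono) simp
  finally have 1: "layer N (monomials bracket (eliminate (d, p, x) ?Y)) \<subseteq> \<dots>" .
  have 2: "layer N (set (residue (d, p, x))) \<subseteq> span (layer N (set (residue (d, p, x) @ E)))"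
    by (rule order_trans[OF layer_mono span_superset]) simp
  have ins: "set (xs @ (d, p, x) # ys) = insert (d, p, x) ?Y" by auto
  have "v \<in> span (layer N (monomials bracket (eliminate (d, p, x) ?Y) \<union> set (residue (d, p, x))))"
    if "v \<in> layer N (monomials bracket (set (xs @ (d, p, x) # ys)))" for v
    using that elimination[OF char x Y] unfolding ins layer_def by blast
  moreover have "span (layer N (monomials bracket (eliminate (d, p, x) ?Y) \<union> set (residue (d, p, x))))
      \<subseteq> span (layer N (set (residue (d, p, x) @ E)))"
    unfolding layer_Un using 1 2 by (intro span_minimal subspace_span) blast
  ultimately show "layer N (monomials bracket (set (xs @ (d, p, x) # ys)))
      \<subseteq> span (layer N (set (residue (d, p, x) @ E)))" by blast
  fix s F k
  assume s: "s * s = 1" and k: "0 < k" "k \<le> N"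
    and F: "\<forall>i\<le>N. F $ i = (1 - (\<Sum>z\<leftarrow>xs @ (d, p, x) # ys. letter_fps s z)) $ i"
  let ?l = "1 - letter_fps s (d, p, x)" and ?F = "F * inverse (1 - letter_fps s (d, p, x))"
  have F': "F $ i = (?l - (\<Sum>z\<leftarrow>xs @ ys. letter_fps s z)) $ i" if "i \<le> N" for i
    using F that by (simp add: algebra_simps)
  have l0: "?l $ 0 = 1" using d by (simp add: letter_fps_def)
  have sum0: "(\<Sum>z\<leftarrow>zs. letter_fps s z) $ 0 = 0" if "\<forall>z\<in>set zs. fst z > 0" for zs :: "(nat \<times> bit \<times> 'v) list"
    using that by (induction zs) (auto simp: letter_fps_def fps_X_power_nth)
  have F0: "F $ 0 = 1" using F'[of 0] l0 sum0[of "xs @ ys"] pos by auto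
  have "log_deriv F = log_deriv (?l * ?F)"
    using inverse_mult_eq_1'[of ?l] l0 by (simp add: mult.left_commute[of ?l])
  also have "\<dots> = log_deriv ?l + log_deriv ?F"
    using l0 F0 by (intro log_deriv_mult) simp_all
  finally have "log_deriv F $ k = log_deriv ?l $ k + log_deriv ?F $ k" by simp
  moreover have "log_deriv ?F $ k = (\<Sum>(d, p, v)\<leftarrow>E. weight s k d p)"
    using E s k elim_list_fps[OF s d F'] unfolding exhausts_def by blast
  ultimately show "log_deriv F $ k = (\<Sum>(d, p, v)\<leftarrow>residue (d, p, x) @ E. weight s k d p)"
    using log_deriv_residue[OF s d k(1)] by simp
qed

text \<open>\<open>j\<close> bounds the number of degrees from \<open>m\<close> to \<open>N\<close>
  still to be cleared. The inner induction removes the letters of degree exactly \<open>m\<close>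
  one by one; when none is left, \<open>m\<close> rises and \<open>j\<close> drops.\<close>

lemma ex_exhausts:
  assumes char: "(2::'k) \<noteq> 0" "(3::'k) \<noteq> 0"
    and "homogeneous (set X)" "\<forall>x\<in>set X. m \<le> fst x" "m > 0" "N < m + j"
  shows "\<exists>E. exhausts N X E"
  using assms(3-)
proof (induction j arbitrary: X m)
  case 0
  then show ?case using exhausts_Nil[of X N] by force
next
  case (Suc j)
  note outer = Suc.IH
  show ?case using Suc.prems
  proof (induction "length (filter (\<lambda>x. fst x = m) X)" arbitrary: X)
    case 0
    then have "\<forall>x\<in>set X. fst x \<noteq> m" by (simp add: filter_empty_conv)
    with 0 have "\<forall>x\<in>set X. Suc m \<le> fst x" by (metis Suc_leI le_neq_implies_less)
    then show ?case using outer[of X "Suc m"] 0 by simp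
  next
    case (Suc r)
    then have "filter (\<lambda>x. fst x = m) X \<noteq> []" by auto
    then obtain x where "x \<in> set X" "fst x = m" by (auto simp: filter_empty_conv)
    then obtain xs p v ys where X: "X = xs @ (m, p, v) # ys" by (metis prod.collapse split_list)
    let ?Z = "elim_list bracket N (m, p, v) (xs @ ys)"
    have ge: "\<forall>y\<in>set (xs @ ys). m \<le> fst y" using Suc.prems X by auto
    have "v \<in> part p" "homogeneous (set (xs @ ys))" using Suc.prems(1) by (auto simp: X homogeneous_def)
    then have "homogeneous (set ?Z)"
      by (meson homogeneous_eliminate homogeneous_subset elim_list_subset)
    moreover have "r = length (filter (\<lambda>z. fst z = m) ?Z)"
      using Suc.hyps(2) Suc.prems length_filter_elim_list[OF ge] by (simp add: X)
    moreover have "\<forall>z\<in>set ?Z. m \<le> fst z" using elim_list_degree[OF ge] by blast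
    ultimately obtain E where "exhausts N ?Z E" using Suc.hyps(1)[of ?Z] Suc.prems by blast
    moreover have "\<forall>z\<in>set X. fst z > 0" using Suc.prems(2,3) less_le_trans by blast
    ultimately have "exhausts N X (residue (m, p, v) @ E)"
      using Suc.prems(1) unfolding X by (intro exhausts_eliminate char)
    then show ?case by blast
  qed
qed

end


section \<open>Central series\<close>

context lie_superalgebra
begin

lemma subspace_upper_central: "subspace (upper_central i)"
proof (induction i)
  case (Suc i)
  then show ?case
    by (auto simp: subspace_def bracket_zero_left bracket_add_left bracket_scale_left)
qed (simp add: subspace_single_0)

text \<open>At \<open>j = 0\<close> the subtraction stays at 0, which is correct because
  \<open>[0, y] = 0\<close>.\<close>

lemma bracket_upper_central: "x \<in> upper_central j \<Longrightarrow> bracket x y \<in> upper_central (j - 1)"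
  by (cases j) (auto simp: bracket_zero_left)

text \<open>Each letter lowers the central index by one. Since \<open>[[v, w], z]\<close> is
  \<open>[v, [w, z]]\<close> up to a multiple of \<open>[[v, z], w]\<close>, the induction
  hypothesis is applied to \<open>[w, z]\<close> at index \<open>j - 1\<close> as well as to
  \<open>z\<close>.\<close>

lemma bracket_monomial_upper_central:
  assumes "(n, p, v) \<in> monomials bracket X" "\<And>z. z \<in> X \<Longrightarrow> fst z = 1" "homogeneous X"
    and "z \<in> part q" "z \<in> upper_central j"
  shows "bracket v z \<in> upper_central (j - n)"
  using assms(1,4,5)
proof (induction arbitrary: z q j rule: monomials.induct)
  case (letter d p v)
  have "bracket v z = - (sign p q *s bracket z v)"
    using super_antisym homogeneousD[OF assms(3) letter(1)] letter(2) by blast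
  moreover have "d = 1" using assms(2)[OF letter(1)] by simp
  ultimately show ?case using bracket_upper_central[OF letter(3)] subspace_upper_central
    by (simp add: subspace_neg subspace_scale)
next
  case (snoc n p v e r w)
  have e: "e = 1" using assms(2)[OF snoc.hyps(2)] by simp
  have v: "v \<in> part p" using monomials_part[OF snoc.hyps(1) assms(3)] .
  have w: "w \<in> part r" using homogeneousD[OF assms(3) snoc.hyps(2)] .
  have wz: "bracket w z = - (sign r q *s bracket z w)" using super_antisym[OF w snoc.prems(1)] .
  have "bracket w z \<in> upper_central (j - 1)" unfolding wz
    using bracket_upper_central[OF snoc.prems(2)] subspace_upper_central
    by (simp add: subspace_neg subspace_scale)
  then have "bracket v (bracket w z) \<in> upper_central (j - 1 - n)"
    using snoc.IH bracket_part[OF w snoc.prems(1)] by blast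
  moreover have "bracket (bracket v z) w \<in> upper_central (j - n - 1)"
    using snoc.IH[OF snoc.prems] by (rule bracket_upper_central)
  moreover have "bracket (bracket v w) z = bracket v (bracket w z) + sign r q *s bracket (bracket v z) w"
    using bracket_bracket[OF v w snoc.prems(1)] .
  ultimately show ?case using subspace_upper_central
    by (simp add: e subspace_add subspace_scale)
qed

lemma bracket_span_upper_central:
  assumes "s \<in> span (layer n (monomials bracket X))" "\<And>z. z \<in> X \<Longrightarrow> fst z = 1" "homogeneous X"
    and "z \<in> part q" "z \<in> upper_central j"
  shows "bracket s z \<in> upper_central (j - n)"
proof -
  have "bracket s z \<in> span (upper_central (j - n))"
    by (rule bracket_span_left[OF assms(1)])
       (auto simp: layer_def intro: span_base bracket_monomial_upper_central[OF _ assms(2-)])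
  then show ?thesis by (metis span_eq_iff subspace_upper_central)
qed

text \<open>If \<open>x\<close> is \<open>s\<close> modulo \<open>Z_(c-k)\<close> and
  \<open>y\<close> is \<open>t\<close> modulo \<open>Z_c\<close>, then
  \<open>[x, y] = [s, t] + [s, y - t] + [x - s, y]\<close>, and the last two terms lie in
  \<open>Z_(c-k-1)\<close>.\<close>

lemma lower_central_mod_upper_central:
  assumes X: "\<And>z. z \<in> X \<Longrightarrow> fst z = 1" "homogeneous X"
    and gen: "\<And>p x. x \<in> part p \<Longrightarrow> \<exists>t. t \<in> part p \<and> t \<in> span (layer 1 X) \<and> x - t \<in> upper_central c"
  shows "k \<le> c \<Longrightarrow> x \<in> lower_central (Suc k) \<Longrightarrow>
    \<exists>s\<in>span (layer (Suc k) (monomials bracket X)). x - s \<in> upper_central (c - k)"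
proof (induction k arbitrary: x)
  case 0
  obtain x0 x1 where x: "x0 \<in> part 0" "x1 \<in> part 1" "x = x0 + x1" using part_sum by blast
  then obtain t0 t1 where t: "t0 \<in> span (layer 1 X)" "x0 - t0 \<in> upper_central c"
    "t1 \<in> span (layer 1 X)" "x1 - t1 \<in> upper_central c" using gen by meson
  have "span (layer 1 X) \<subseteq> span (layer (Suc 0) (monomials bracket X))"
    by (rule span_mono) (auto simp: layer_def intro: monomials.letter)
  then have "t0 + t1 \<in> span (layer (Suc 0) (monomials bracket X))" using t by (blast intro: span_add)
  moreover have "x - (t0 + t1) \<in> upper_central c"
    using subspace_add[OF subspace_upper_central t(2,4)] by (simp add: x add_diff_add)
  ultimately show ?case by auto
next
  case (Suc k)
  define T where "T = {s + z |s z. s \<in> span (layer (Suc (Suc k)) (monomials bracket X))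
    \<and> z \<in> upper_central (c - Suc k)}"
  have "subspace T" unfolding T_def
    by (intro subspace_sums subspace_span subspace_upper_central)
  moreover have "{bracket x y |x y. x \<in> lower_central (Suc k)} \<subseteq> T"
  proof clarify
    fix x y assume "x \<in> lower_central (Suc k)"
    then obtain s where s: "s \<in> span (layer (Suc k) (monomials bracket X))" "x - s \<in> upper_central (c - k)"
      using Suc by (auto simp del: lower_central.simps)
    \<comment> \<open>Homogeneous \<open>y\<close> come first, because
      \<open>bracket_span_upper_central\<close> rests on super antisymmetry and takes a homogeneous
      second factor.\<close>
    have "bracket s y \<in> T" if y: "y \<in> part p" for y p
    proof -
      obtain t where t: "t \<in> part p" "t \<in> span (layer 1 X)" "y - t \<in> upper_central c"
        using gen[OF y] by blast
      have "bracket s t \<in> span (layer (Suc (Suc k)) (monomials bracket X))"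
      proof (rule bracket_span_right[OF t(2)])
        fix w assume "w \<in> layer 1 X"
        then obtain q where "(1, q, w) \<in> X" by (auto simp: layer_def)
        then show "bracket s w \<in> span (layer (Suc (Suc k)) (monomials bracket X))"
          using bracket_layer_snoc[OF s(1)] by force
      qed
      moreover have "y - t \<in> part p" using subspace_diff[OF subspace_part y t(1)] .
      then have "bracket s (y - t) \<in> upper_central (c - Suc k)"
        using bracket_span_upper_central[OF s(1) X _ t(3)] by blast
      moreover have "bracket s (y - t) = bracket s y - bracket s t"
        by (rule module_hom.diff[OF module_hom_bracket(1)])
      ultimately show ?thesis unfolding T_def
        by (intro CollectI exI[of _ "bracket s t"] exI[of _ "bracket s (y - t)"]) simp
    qed
    moreover obtain y0 y1 where y: "y0 \<in> part 0" "y1 \<in> part 1" "y = y0 + y1" using part_sum by blast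
    ultimately have "bracket s y \<in> T" using \<open>subspace T\<close>
      unfolding y(3) bracket_add_right by (metis subspace_add)
    moreover have "bracket (x - s) y \<in> T"
    proof -
      have "bracket (x - s) y \<in> upper_central (c - Suc k)"
        using bracket_upper_central[OF s(2)] by simp
      then show ?thesis unfolding T_def
        by (intro CollectI exI[of _ 0] exI[of _ "bracket (x - s) y"]) (simp add: span_zero)
    qed
    moreover have "bracket x y = bracket s y + bracket (x - s) y"
      unfolding bracket_add_left[symmetric] by simp
    ultimately show "bracket x y \<in> T" using \<open>subspace T\<close> by (simp add: subspace_add)
  qed
  ultimately have "lower_central (Suc (Suc k)) \<subseteq> T" by (simp add: span_minimal)
  then obtain s z where "s \<in> span (layer (Suc (Suc k)) (monomials bracket X))"
    "z \<in> upper_central (c - Suc k)" "x = s + z"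
    using Suc.prems(2) unfolding T_def by blast
  then show ?case by (intro bexI[of _ s]) simp_all
qed

lemma monomials_lower_central:
  assumes "(n, p, v) \<in> monomials bracket X" "\<And>z. z \<in> X \<Longrightarrow> fst z = 1"
  shows "v \<in> lower_central n \<and> n > 0"
  using assms(1)
proof (induction rule: monomials.induct)
  case (letter d p v)
  then show ?case using assms(2) by force
next
  case (snoc n p v e q w)
  then obtain k where "n = Suc k" using gr0_implies_Suc by blast
  moreover have "e = 1" using assms(2)[OF snoc.hyps(2)] by simp
  ultimately show ?case using snoc.IH by (auto intro!: span_base)
qed

text \<open>At \<open>k = c\<close> the error in \<open>lower_central_mod_upper_central\<close> lies
  in \<open>upper_central 0 = {0}\<close>. Conversely, a monomial in \<open>c + 1\<close> letters of
  degree 1 is a left-normed bracket.\<close>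

lemma lower_central_eq_span:
  assumes X: "\<And>z. z \<in> X \<Longrightarrow> fst z = 1" "homogeneous X"
    and gen: "\<And>p x. x \<in> part p \<Longrightarrow> \<exists>t. t \<in> part p \<and> t \<in> span (layer 1 X) \<and> x - t \<in> upper_central c"
  shows "lower_central (Suc c) = span (layer (Suc c) (monomials bracket X))"
proof
  show "lower_central (Suc c) \<subseteq> span (layer (Suc c) (monomials bracket X))"
    using lower_central_mod_upper_central[OF X gen, of c] by fastforce
  have "layer (Suc c) (monomials bracket X) \<subseteq> lower_central (Suc c)"
    using monomials_lower_central[OF _ X(1)] by (auto simp: layer_def)
  moreover have "subspace (lower_central (Suc c))" by (cases c) simp_all
  ultimately show "span (layer (Suc c) (monomials bracket X)) \<subseteq> lower_central (Suc c)"
    by (rule span_minimal)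
qed

section \<open>From the superdimension of the quotient to the dimension bound\<close>

lemma has_dim_modE:
  assumes "has_dim_mod W U d" "0 \<in> W"
  obtains B where "finite B" "card B = d" "B \<subseteq> U" "\<And>x. x \<in> U \<Longrightarrow> \<exists>t\<in>span B. x - t \<in> W"
proof -
  obtain B where B: "finite B" "card B = d" "B \<subseteq> U"
    and U: "\<And>x. x \<in> U \<Longrightarrow> \<exists>a. x +o W = (\<Sum>b\<in>B. a b *s b) +o W"
    using assms(1) unfolding has_dim_mod_def by blast
  have "\<exists>t\<in>span B. x - t \<in> W" if "x \<in> U" for x
  proof -
    obtain a where a: "x +o W = (\<Sum>b\<in>B. a b *s b) +o W" using U[OF \<open>x \<in> U\<close>] by blast
    \<comment> \<open>As \<open>0 \<in> W\<close>, \<open>x\<close> lies in its own coset, so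
      equality of cosets expresses \<open>x\<close> up to an element of \<open>W\<close>.\<close>
    have "x \<in> x +o W" using assms(2) by (force simp: elt_set_plus_def)
    then obtain w where "w \<in> W" "x = (\<Sum>b\<in>B. a b *s b) + w"
      unfolding a by (auto simp: elt_set_plus_def)
    then show ?thesis
      by (intro bexI[of _ "\<Sum>b\<in>B. a b *s b"]) (auto intro: span_sum span_scale span_base)
  qed
  then show thesis using B that by blast
qed

lemma lower_central_bound:
  assumes char: "(2::'k) \<noteq> 0" "(3::'k) \<noteq> 0" and "quotient_superdim (upper_central c) m n"
  obtains S where "finite S" "lower_central (c + 1) \<subseteq> span S"
    "real (card S) \<le> 1 / real (c + 1) * (\<Sum>a | a dvd c + 1.
      real_of_int (moebius a) * (real m - (- 1) ^ a * real n) ^ ((c + 1) div a))"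
proof -
  have 0: "0 \<in> upper_central c" using subspace_0[OF subspace_upper_central] .
  obtain B0 where B0: "finite B0" "card B0 = m" "B0 \<subseteq> part 0"
      "\<And>x. x \<in> part 0 \<Longrightarrow> \<exists>t\<in>span B0. x - t \<in> upper_central c"
    using assms(3) has_dim_modE[OF _ 0] unfolding quotient_superdim_def by metis
  obtain B1 where B1: "finite B1" "card B1 = n" "B1 \<subseteq> part 1"
      "\<And>x. x \<in> part 1 \<Longrightarrow> \<exists>t\<in>span B1. x - t \<in> upper_central c"
    using assms(3) has_dim_modE[OF _ 0] unfolding quotient_superdim_def by metis
  obtain l0 l1 where l: "distinct l0" "set l0 = B0" "distinct l1" "set l1 = B1"
    using B0(1) B1(1) finite_distinct_list by meson
  \<comment> \<open>All letters get degree 1, so the degree of a monomial is its number of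
    factors.\<close>
  define X where "X = map (\<lambda>b. (1::nat, 0::bit, b)) l0 @ map (\<lambda>b. (1, 1, b)) l1"
  have X1: "fst z = 1" if "z \<in> set X" for z using that by (auto simp: X_def)
  have hom: "homogeneous (set X)" using B0(3) B1(3) l by (auto simp: X_def homogeneous_def)
  have B01: "B0 \<subseteq> layer 1 (set X)" "B1 \<subseteq> layer 1 (set X)" using l by (auto simp: X_def layer_def)
  have gen: "\<exists>t. t \<in> part p \<and> t \<in> span (layer 1 (set X)) \<and> x - t \<in> upper_central c"
    if "x \<in> part p" for p x
  proof (cases "p = 0")
    case True
    then obtain t where "t \<in> span B0" "x - t \<in> upper_central c" using B0(4)[of x] \<open>x \<in> part p\<close> \<open>p = 0\<close> by blast
    moreover have "span B0 \<subseteq> part 0" using B0(3) subspace_part by (rule span_minimal)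
    ultimately show ?thesis using True span_mono[OF B01(1)] by blast
  next
    case False
    then have "p = 1" by simp
    then obtain t where "t \<in> span B1" "x - t \<in> upper_central c" using B1(4)[of x] \<open>x \<in> part p\<close> \<open>p = 1\<close> by blast
    moreover have "span B1 \<subseteq> part 1" using B1(3) subspace_part by (rule span_minimal)
    ultimately show ?thesis using \<open>p = 1\<close> span_mono[OF B01(2)] by blast
  qed
  let ?N = "c + 1"
  obtain E where E: "exhausts ?N X E" using ex_exhausts[OF char hom, of 1 ?N ?N] X1 by auto
  define S where "S = layer ?N (set E)"
  have S: "S = (\<lambda>z. snd (snd z)) ` set (filter (\<lambda>z. fst z = ?N) E)"
    unfolding S_def layer_def by force
  \<comment> \<open>Different letters of degree \<open>c + 1\<close> may share a value, hence only
    an inequality.\<close>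
  then have card: "card S \<le> length (filter (\<lambda>z. fst z = ?N) E)"
    using card_image_le[of "set (filter (\<lambda>z. fst z = ?N) E)"] card_length
    by (metis List.finite_set order_trans)
  have "lower_central ?N \<subseteq> span S"
    using lower_central_eq_span[OF X1 hom gen] E
    by (simp add: S_def exhausts_def span_minimal del: lower_central.simps)
  have sum_X: "(\<Sum>x\<leftarrow>X. letter_fps s x) = fps_const (real m + s * real n) * fps_X ^ 1" for s
  proof -
    have "(\<Sum>x\<leftarrow>X. letter_fps s x) = of_nat m * fps_X + of_nat n * (fps_const s * fps_X)"
      using l B0(2) B1(2) distinct_card[of l0] distinct_card[of l1]
      by (simp add: X_def letter_fps_def comp_def sum_list_triv)
    then show ?thesis
      by (simp add: fps_of_nat[symmetric] distrib_right mult_ac flip: fps_const_add fps_const_mult)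
  qed
  \<comment> \<open>The generating function of \<open>X\<close> is \<open>(m + s n) X\<close>, and
    the logarithmic derivative of \<open>1 - (m + s n) X\<close> has the powers of
    \<open>m + s n\<close> as coefficients.\<close>
  have weight: "(real m + s * real n) ^ k = (\<Sum>(d, p, v)\<leftarrow>E. weight s k d p)"
    if "s * s = 1" "0 < k" "k \<le> ?N" for s k
  proof -
    have "log_deriv (1 - (\<Sum>x\<leftarrow>X. letter_fps s x)) $ k = (\<Sum>(d, p, v)\<leftarrow>E. weight s k d p)"
      using E that unfolding exhausts_def by blast
    then show ?thesis unfolding sum_X using that(2) log_deriv_one_minus_monom[of 1 k "real m + s * real n"] by simp
  qed
  have "(\<Sum>a | a dvd ?N. real_of_int (moebius a) * (real m - (- 1) ^ a * real n) ^ (?N div a))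
    = (\<Sum>a | a dvd ?N. real_of_int (moebius a) *
      (\<Sum>(d, p, v) \<leftarrow> E. weight (- ((- 1) ^ a)) (?N div a) d p))"
  proof (rule sum.cong)
    fix a assume "a \<in> {a. a dvd ?N}"
    then have "0 < ?N div a" "?N div a \<le> ?N"
      using dvd_imp_le[of a ?N] dvd_pos_nat[of ?N a] by (auto simp: div_greater_zero_iff)
    then show "real_of_int (moebius a) * (real m - (- 1) ^ a * real n) ^ (?N div a)
      = real_of_int (moebius a) * (\<Sum>(d, p, v) \<leftarrow> E. weight (- ((- 1) ^ a)) (?N div a) d p)"
      using weight[of "- ((- 1) ^ a)" "?N div a"] by (simp flip: power_mult_distrib)
  qed simp
  also have "\<dots> = real ?N * real (length (filter (\<lambda>z. fst z = ?N) E))"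
    using E by (intro moebius_count) (auto simp: exhausts_def)
  finally have "1 / real ?N * (\<Sum>a | a dvd ?N. real_of_int (moebius a) *
      (real m - (- 1) ^ a * real n) ^ (?N div a)) = real (length (filter (\<lambda>z. fst z = ?N) E))"
    by (simp add: field_simps)
  with card have "real (card S) \<le> 1 / real ?N * (\<Sum>a | a dvd ?N. real_of_int (moebius a) *
      (real m - (- 1) ^ a * real n) ^ (?N div a))" by simp
  moreover have "finite S" unfolding S by simp
  ultimately show thesis using that \<open>lower_central ?N \<subseteq> span S\<close> by blast
qed

end

lemma of_nat_neq_0_if_CHAR_neq:
  assumes "prime p" "CHAR('k::field) \<noteq> p"
  shows "of_nat p \<noteq> (0::'k)"
proof
  assume "of_nat p = (0::'k)"
  then have "CHAR('k) dvd p" by (simp add: of_nat_eq_0_iff_char_dvd)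
  then have "CHAR('k) = 1 \<or> CHAR('k) = p" using assms(1) prime_nat_iff by blast
  then show False using assms(2) CHAR_not_1'[where ?'a = 'k] by auto
qed

text \<open>The finite spanning set is asserted along with the inequality because \<open>dim\<close>
  is 0 on infinite-dimensional spaces.\<close>

theorem theorem5p1:
  fixes scale :: "'k::field \<Rightarrow> 'v::ab_group_add \<Rightarrow> 'v"
    and part :: "bit \<Rightarrow> 'v set"
    and bracket :: "'v \<Rightarrow> 'v \<Rightarrow> 'v"
    and c m n :: nat
  assumes "CHAR('k) \<noteq> 2" and "CHAR('k) \<noteq> 3"
    and "lie_superalgebra scale part bracket"
    and "c \<ge> 1"
    and "lie_superalgebra.quotient_superdim scale part
           (lie_superalgebra.upper_central bracket c) m n"
  shows "(\<exists>B. finite B \<and>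
            module.span scale B = lie_superalgebra.lower_central scale bracket (c + 1))
       \<and> real (vector_space.dim scale (lie_superalgebra.lower_central scale bracket (c + 1)))
         \<le> 1 / real (c + 1) *
            (\<Sum>a | a dvd c + 1.
               real_of_int (moebius a) * (real m - (- 1) ^ a * real n) ^ ((c + 1) div a))"
proof -
  interpret lie_superalgebra scale part bracket by fact
  have char: "(2::'k) \<noteq> 0" "(3::'k) \<noteq> 0"
    using of_nat_neq_0_if_CHAR_neq[where ?'k = 'k and p = 2]
      of_nat_neq_0_if_CHAR_neq[where ?'k = 'k and p = 3] assms(1,2) by simp_all
  obtain S where S: "finite S" "lower_central (c + 1) \<subseteq> span S"
    "real (card S) \<le> 1 / real (c + 1) * (\<Sum>a | a dvd c + 1.
      real_of_int (moebius a) * (real m - (- 1) ^ a * real n) ^ ((c + 1) div a))"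
    by (rule lower_central_bound[OF char assms(5)])
  have sub: "subspace (lower_central (c + 1))" by (cases c) simp_all
  obtain B where B: "B \<subseteq> lower_central (c + 1)" "independent B" "lower_central (c + 1) \<subseteq> span B"
    by (rule basis_exists)
  then have "finite B" using independent_span_bound[OF S(1) B(2)] S(2) by blast
  moreover have "span B = lower_central (c + 1)"
    using B span_minimal[OF B(1) sub] by blast
  moreover have "dim (lower_central (c + 1)) \<le> card S" using S by (intro dim_le_card)
  then have "real (dim (lower_central (c + 1))) \<le> real (card S)" by simp
  ultimately show ?thesis using S(3) by auto
qed

end
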